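(* The rotationally symmetric map $\varphi:(S^2,dr^2+\sin^2r\,d\theta^2)\to(\mathbb{R}^2,d\rho^2+(\rho+1)d\phi^2)$ with $$\varphi(r,\theta)=\left(\tfrac14\left(\ln\tan\tfrac r2\right)^2-\ln\sin r+1,\ \theta\right)$$ (defined on the sphere with its north and south poles deleted, $0<r<\pi$) is a proper biharmonic map.
   Context: $(r,\theta)$ are geodesic polar coordinates on the unit 2-sphere, $r\in(0,\pi)$. The target is the surface with coordinates $(\rho,\phi)$ and metric $d\rho^2+(\rho+1)d\phi^2$, on the region $\rho+1>0$. The map is given by its expression in these coordinates. The tension field of a map $\varphi:(M,g)\to(N,h)$ is $\tau(\varphi)=\mathrm{Tr}_g\nabla d\varphi$; $\varphi$ is harmonic if $\tau(\varphi)=0$, and biharmonic if $\tau_2(\varphi)=\mathrm{Tr}_g(\nabla^\varphi\nabla^\varphi-\nabla^\varphi_{\nabla^M})\tau(\varphi)-\mathrm{Tr}_gR^N(d\varphi,\tau(\varphi))d\varphi=0$, where $R^N(X,Y)Z=[\nabla^N_X,\nabla^N_Y]Z-\nabla^N_{[X,Y]}Z$. A proper biharmonic map is a biharmonic map that is not harmonic. *)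

theory Defs
  imports "HOL-Analysis.Analysis"
begin

(* Riemannian geometry in one coordinate chart. A manifold is an open set U of coordinate values
   in real^'n together with the component matrix x \<mapsto> (g_ij(x)) of its metric. Vector fields,
   and sections of the pull-back bundle of a map, are given by their component vectors in the
   coordinate frames, as functions on the whole coordinate space; only values on U matter.
   An angular coordinate ranges over all reals: this is the universal cover of the region it
   describes, which contains every local choice of the angle; all differential conditions
   below are pointwise and local, so nothing is lost. *)

section \<open>Smooth functions on open sets\<close>

primrec Ck_on :: "nat \<Rightarrow> ('a::euclidean_space \<Rightarrow> 'b::real_normed_vector) \<Rightarrow> 'a set \<Rightarrow> bool" where
  "Ck_on 0 f U \<longleftrightarrow> continuous_on U f"
| "Ck_on (Suc k) f U \<longleftrightarrow>
     (\<forall>x\<in>U. f differentiable at x) \<and> (\<forall>v. Ck_on k (\<lambda>x. frechet_derivative f (at x) v) U)"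

definition smooth_on :: "('a::euclidean_space \<Rightarrow> 'b::real_normed_vector) \<Rightarrow> 'a set \<Rightarrow> bool" where
  "smooth_on f U \<longleftrightarrow> (\<forall>k. Ck_on k f U)"

section \<open>Metric, Levi-Civita connection, curvature\<close>

definition riemannian_metric_on :: "(real^'n) set \<Rightarrow> (real^'n \<Rightarrow> real^'n^'n) \<Rightarrow> bool" where
  "riemannian_metric_on U g \<longleftrightarrow> open U \<and> smooth_on g U \<and>
     (\<forall>x\<in>U. transpose (g x) = g x \<and> (\<forall>v. v \<noteq> 0 \<longrightarrow> v \<bullet> (g x *v v) > 0))"

definition partial_deriv :: "'n \<Rightarrow> (real^'n \<Rightarrow> real) \<Rightarrow> real^'n \<Rightarrow> real" where
  "partial_deriv i f x = frechet_derivative f (at x) (axis i 1)"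

(* christoffel g x k i j is \<Gamma>^k_ij at the point x. *)
definition christoffel :: "(real^'n \<Rightarrow> real^'n^'n) \<Rightarrow> real^'n \<Rightarrow> 'n \<Rightarrow> 'n \<Rightarrow> 'n \<Rightarrow> real" where
  "christoffel g x k i j = 1/2 * (\<Sum>l\<in>UNIV. matrix_inv (g x) $ k $ l *
     (partial_deriv i (\<lambda>y. g y $ j $ l) x + partial_deriv j (\<lambda>y. g y $ i $ l) x
      - partial_deriv l (\<lambda>y. g y $ i $ j) x))"

definition christoffel_form :: "(real^'n \<Rightarrow> real^'n^'n) \<Rightarrow> real^'n \<Rightarrow> real^'n \<Rightarrow> real^'n \<Rightarrow> real^'n" where
  "christoffel_form g x u v = (\<chi> k. \<Sum>i\<in>UNIV. \<Sum>j\<in>UNIV. christoffel g x k i j * u $ i * v $ j)"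

(* (\<nabla>_X Y)(x) *)
definition cov_deriv ::
  "(real^'n \<Rightarrow> real^'n^'n) \<Rightarrow> (real^'n \<Rightarrow> real^'n) \<Rightarrow> (real^'n \<Rightarrow> real^'n) \<Rightarrow> real^'n \<Rightarrow> real^'n" where
  "cov_deriv g X Y x = frechet_derivative Y (at x) (X x) + christoffel_form g x (X x) (Y x)"

definition lie_bracket ::
  "(real^'n \<Rightarrow> real^'n) \<Rightarrow> (real^'n \<Rightarrow> real^'n) \<Rightarrow> real^'n \<Rightarrow> real^'n" where
  "lie_bracket X Y x = frechet_derivative Y (at x) (X x) - frechet_derivative X (at x) (Y x)"

(* R(X,Y)Z = \<nabla>_X \<nabla>_Y Z - \<nabla>_Y \<nabla>_X Z - \<nabla>_[X,Y] Z for vector fields *)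
definition curvature_field ::
  "(real^'n \<Rightarrow> real^'n^'n) \<Rightarrow> (real^'n \<Rightarrow> real^'n) \<Rightarrow> (real^'n \<Rightarrow> real^'n) \<Rightarrow> (real^'n \<Rightarrow> real^'n)
    \<Rightarrow> real^'n \<Rightarrow> real^'n" where
  "curvature_field g X Y Z x =
     cov_deriv g X (cov_deriv g Y Z) x - cov_deriv g Y (cov_deriv g X Z) x
     - cov_deriv g (lie_bracket X Y) Z x"

(* R is a tensor; on tangent vectors at x it is evaluated by extending them to vector fields
   with constant components. *)
definition curvature ::
  "(real^'n \<Rightarrow> real^'n^'n) \<Rightarrow> real^'n \<Rightarrow> real^'n \<Rightarrow> real^'n \<Rightarrow> real^'n \<Rightarrow> real^'n" where
  "curvature g x u v w = curvature_field g (\<lambda>_. u) (\<lambda>_. v) (\<lambda>_. w) x"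

(* Tr_g B = g^ij B(\<partial>_i, \<partial>_j) at x, where B X Y is the value at x of an expression that is
   tensorial in the vector fields X and Y. *)
definition metric_trace ::
  "(real^'m \<Rightarrow> real^'m^'m) \<Rightarrow> real^'m \<Rightarrow>
    ((real^'m \<Rightarrow> real^'m) \<Rightarrow> (real^'m \<Rightarrow> real^'m) \<Rightarrow> real^'n) \<Rightarrow> real^'n" where
  "metric_trace g x B =
     (\<Sum>i\<in>UNIV. \<Sum>j\<in>UNIV. matrix_inv (g x) $ i $ j *\<^sub>R B (\<lambda>_. axis i 1) (\<lambda>_. axis j 1))"

section \<open>Maps between Riemannian manifolds\<close>

(* d\<phi>(X), a section of the pull-back bundle \<phi>^{-1}TN *)
definition push_forward ::
  "(real^'m \<Rightarrow> real^'n) \<Rightarrow> (real^'m \<Rightarrow> real^'m) \<Rightarrow> real^'m \<Rightarrow> real^'n" where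
  "push_forward \<phi> X x = frechet_derivative \<phi> (at x) (X x)"

(* pull-back connection: (\<nabla>^\<phi>_X V)(x) for a section V of \<phi>^{-1}TN *)
definition pullback_deriv ::
  "(real^'n \<Rightarrow> real^'n^'n) \<Rightarrow> (real^'m \<Rightarrow> real^'n) \<Rightarrow> (real^'m \<Rightarrow> real^'m) \<Rightarrow> (real^'m \<Rightarrow> real^'n)
    \<Rightarrow> real^'m \<Rightarrow> real^'n" where
  "pullback_deriv h \<phi> X V x =
     frechet_derivative V (at x) (X x) + christoffel_form h (\<phi> x) (push_forward \<phi> X x) (V x)"

(* (\<nabla>d\<phi>)(X,Y) = \<nabla>^\<phi>_X (d\<phi>(Y)) - d\<phi>(\<nabla>^M_X Y) *)
definition second_fundamental_form ::
  "(real^'m \<Rightarrow> real^'m^'m) \<Rightarrow> (real^'n \<Rightarrow> real^'n^'n) \<Rightarrow> (real^'m \<Rightarrow> real^'n)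
    \<Rightarrow> (real^'m \<Rightarrow> real^'m) \<Rightarrow> (real^'m \<Rightarrow> real^'m) \<Rightarrow> real^'m \<Rightarrow> real^'n" where
  "second_fundamental_form g h \<phi> X Y x =
     pullback_deriv h \<phi> X (push_forward \<phi> Y) x - push_forward \<phi> (cov_deriv g X Y) x"

definition tension_field ::
  "(real^'m \<Rightarrow> real^'m^'m) \<Rightarrow> (real^'n \<Rightarrow> real^'n^'n) \<Rightarrow> (real^'m \<Rightarrow> real^'n) \<Rightarrow> real^'m \<Rightarrow> real^'n" where
  "tension_field g h \<phi> x = metric_trace g x (\<lambda>X Y. second_fundamental_form g h \<phi> X Y x)"

definition bitension_field ::
  "(real^'m \<Rightarrow> real^'m^'m) \<Rightarrow> (real^'n \<Rightarrow> real^'n^'n) \<Rightarrow> (real^'m \<Rightarrow> real^'n) \<Rightarrow> real^'m \<Rightarrow> real^'n" where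
  "bitension_field g h \<phi> x =
     (let \<tau> = tension_field g h \<phi> in
      metric_trace g x (\<lambda>X Y. pullback_deriv h \<phi> X (pullback_deriv h \<phi> Y \<tau>) x
                               - pullback_deriv h \<phi> (cov_deriv g X Y) \<tau> x)
      - metric_trace g x (\<lambda>X Y. curvature h (\<phi> x) (push_forward \<phi> X x) (\<tau> x) (push_forward \<phi> Y x)))"

definition smooth_riemannian_map ::
  "(real^'m) set \<Rightarrow> (real^'m \<Rightarrow> real^'m^'m) \<Rightarrow> (real^'n) set \<Rightarrow> (real^'n \<Rightarrow> real^'n^'n)
    \<Rightarrow> (real^'m \<Rightarrow> real^'n) \<Rightarrow> bool" where
  "smooth_riemannian_map U g V h \<phi> \<longleftrightarrow>
     riemannian_metric_on U g \<and> riemannian_metric_on V h \<and> smooth_on \<phi> U \<and> \<phi> ` U \<subseteq> V"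

definition harmonic_map ::
  "(real^'m) set \<Rightarrow> (real^'m \<Rightarrow> real^'m^'m) \<Rightarrow> (real^'n) set \<Rightarrow> (real^'n \<Rightarrow> real^'n^'n)
    \<Rightarrow> (real^'m \<Rightarrow> real^'n) \<Rightarrow> bool" where
  "harmonic_map U g V h \<phi> \<longleftrightarrow>
     smooth_riemannian_map U g V h \<phi> \<and> (\<forall>x\<in>U. tension_field g h \<phi> x = 0)"

definition biharmonic_map ::
  "(real^'m) set \<Rightarrow> (real^'m \<Rightarrow> real^'m^'m) \<Rightarrow> (real^'n) set \<Rightarrow> (real^'n \<Rightarrow> real^'n^'n)
    \<Rightarrow> (real^'m \<Rightarrow> real^'n) \<Rightarrow> bool" where
  "biharmonic_map U g V h \<phi> \<longleftrightarrow>
     smooth_riemannian_map U g V h \<phi> \<and> (\<forall>x\<in>U. bitension_field g h \<phi> x = 0)"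

definition proper_biharmonic_map ::
  "(real^'m) set \<Rightarrow> (real^'m \<Rightarrow> real^'m^'m) \<Rightarrow> (real^'n) set \<Rightarrow> (real^'n \<Rightarrow> real^'n^'n)
    \<Rightarrow> (real^'m \<Rightarrow> real^'n) \<Rightarrow> bool" where
  "proper_biharmonic_map U g V h \<phi> \<longleftrightarrow> biharmonic_map U g V h \<phi> \<and> \<not> harmonic_map U g V h \<phi>"

section \<open>The sphere without poles and the target surface\<close>

(* Coordinates (r,\<theta>) = (x $ 1, x $ 2) and (\<rho>,\<phi>) = (y $ 1, y $ 2). *)

definition sphere_polar_domain :: "(real^2) set" where
  "sphere_polar_domain = {x. 0 < x $ 1 \<and> x $ 1 < pi}"

definition sphere_polar_metric :: "real^2 \<Rightarrow> real^2^2" where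
  "sphere_polar_metric x = vector [vector [1, 0], vector [0, (sin (x $ 1))\<^sup>2]]"

definition target_domain :: "(real^2) set" where
  "target_domain = {y. y $ 1 + 1 > 0}"

definition target_metric :: "real^2 \<Rightarrow> real^2^2" where
  "target_metric y = vector [vector [1, 0], vector [0, y $ 1 + 1]]"

end

theory Submission
  imports Defs
begin

text \<open>
  Both metrics have the form \<open>dr\<^sup>2 + w(r) d\<theta>\<^sup>2\<close>, with \<open>w = sin\<^sup>2\<close> on the sphere and
  \<open>h(\<rho>) = \<rho> + 1\<close> on the target, and the map has the form \<open>(r, \<theta>) \<mapsto> (F(r), \<theta>)\<close>. For such
  data symmetry reduces everything to one function of \<open>r\<close>: the tension field is radial,
  \<open>\<tau> = T(r) \<partial>\<^sub>\<rho>\<close> with \<open>T = F'' + w'F'/(2w) - h'(F)/(2w)\<close> (lemma \<open>tension_field_eq\<close>), and the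
  bitension field is again radial, with component \<open>T'' + w'T'/(2w) - h''(F)T/(2w)\<close>
  (lemma \<open>bitension_field_eq\<close>). The only zeroth-order term that survives is the one with
  \<open>h''\<close>: differentiating \<open>\<partial>\<^sub>\<rho>\<close> twice along the circles contributes \<open>-(h')\<^sup>2/(4h)\<close>, and this
  is cancelled by the corresponding part of the curvature.

  Hence for an affine \<open>h\<close> a constant \<open>T\<close> makes the map biharmonic, and a nonzero constant makes
  it proper. The given profile is a solution of \<open>T = 1\<close>: with \<open>L = ln tan(r/2)\<close>, so that
  \<open>L' = 1/sin r\<close>, one has \<open>F' = L/(2 sin r) - cot r\<close>, the terms with \<open>L\<close> cancel in \<open>T\<close>, and what
  remains is \<open>(1 - cos\<^sup>2 r)/sin\<^sup>2 r\<close> (lemma \<open>profile_tension\<close>). Finally \<open>F \<ge> 1\<close>, so the image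
  lies in the region where the target metric is positive definite.

  Being a map of Riemannian manifolds also requires smoothness of the metrics and of the map.
  It follows from the closure of \<open>C\<^sup>k\<close> functions under the arithmetic operations, \<open>ln\<close>,
  \<open>sin\<close> and \<open>cos\<close>.
\<close>

section \<open>Closure properties of smooth functions\<close>

lemma frechet_derivative_eqI:
  assumes "(f has_derivative f') (at x)" "open U" "x \<in> U" "\<And>y. y \<in> U \<Longrightarrow> g y = f y"
  shows "frechet_derivative g (at x) = f'"
  using frechet_derivative_at[OF has_derivative_transform_within_open[OF assms(1-3)]] assms(4)
  by metis

text \<open>
  Openness matters here: the derivatives that define \<open>Ck_on\<close> are taken in the full space, and
  they agree for two functions equal on \<open>U\<close> because \<open>U\<close> is a neighbourhood of each of its points.
\<close>
lemma Ck_on_cong: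
  assumes "Ck_on k f U" "open U" "\<And>x. x \<in> U \<Longrightarrow> f x = g x"
  shows "Ck_on k g U"
  using assms
proof (induction k arbitrary: f g)
  case 0
  then show ?case
    by (metis Ck_on.simps(1) continuous_on_cong)
next
  case (Suc k)
  have g: "(g has_derivative frechet_derivative f (at x)) (at x)" if "x \<in> U" for x
    using Suc.prems that
    by (metis Ck_on.simps(2) frechet_derivative_works has_derivative_transform_within_open)
  have "Ck_on k (\<lambda>x. frechet_derivative g (at x) v) U" for v
  proof (rule Suc.IH)
    show "Ck_on k (\<lambda>x. frechet_derivative f (at x) v) U"
      using Suc.prems(1) by simp
    show "frechet_derivative f (at x) v = frechet_derivative g (at x) v" if "x \<in> U" for x
      using frechet_derivative_at[OF g[OF that]] by simp
  qed (rule Suc.prems)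
  with g show ?case
    by (auto simp: differentiable_def)
qed

text \<open>
  The form in which the definition is used below: any known formula for the derivative may
  replace \<open>frechet_derivative\<close>, so that the usual rules of differentiation apply.
\<close>
lemma Ck_on_Suc_has_derivativeI:
  assumes "open U" "\<And>x. x \<in> U \<Longrightarrow> (f has_derivative f' x) (at x)"
    and "\<And>v. Ck_on k (\<lambda>x. f' x v) U"
  shows "Ck_on (Suc k) f U"
proof -
  have "Ck_on k (\<lambda>x. frechet_derivative f (at x) v) U" for v
    by (rule Ck_on_cong[OF assms(3)[of v] assms(1)]) (metis assms(2) frechet_derivative_at)
  then show ?thesis
    using assms(2) by (auto simp: differentiable_def)
qed

lemma Ck_on_SucD:
  assumes "Ck_on (Suc k) f U"
  shows "x \<in> U \<Longrightarrow> (f has_derivative frechet_derivative f (at x)) (at x)"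
    and "Ck_on k (\<lambda>x. frechet_derivative f (at x) v) U"
  using assms by (auto simp: frechet_derivative_works[symmetric])

lemma Ck_on_Suc_imp: "Ck_on (Suc k) f U \<Longrightarrow> Ck_on k f U"
proof (induction k arbitrary: f)
  case 0
  then show ?case
    by (auto intro!: continuous_at_imp_continuous_on differentiable_imp_continuous_within)
next
  case (Suc k)
  then show ?case by (metis Ck_on.simps(2))
qed

lemma Ck_on_const: "open U \<Longrightarrow> Ck_on k (\<lambda>x. c) U"
proof (induction k arbitrary: c)
  case (Suc k)
  show ?case
    by (rule Ck_on_Suc_has_derivativeI[where f' = "\<lambda>_ _. 0"]) (use Suc in auto)
qed auto

lemma Ck_on_bounded_linear:
  assumes "bounded_linear L" "open U" "Ck_on k f U"
  shows "Ck_on k (\<lambda>x. L (f x)) U"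
  using assms(3)
proof (induction k arbitrary: f)
  case 0
  then show ?case
    using assms(1) by (auto intro: bounded_linear.continuous_on)
next
  case (Suc k)
  show ?case
    by (rule Ck_on_Suc_has_derivativeI[OF assms(2)])
      (auto intro: bounded_linear.has_derivative[OF assms(1)] Ck_on_SucD[OF Suc.prems] Suc.IH)
qed

lemma Ck_on_ident: "open U \<Longrightarrow> Ck_on k (\<lambda>x. x) U"
proof (cases k)
  case (Suc j)
  assume "open U"
  then show ?thesis
    unfolding Suc
    by (rule Ck_on_Suc_has_derivativeI[where f' = "\<lambda>_ v. v"]) (auto intro: Ck_on_const \<open>open U\<close>)
qed auto

lemma Ck_on_add:
  assumes "open U" "Ck_on k f U" "Ck_on k g U"
  shows "Ck_on k (\<lambda>x. f x + g x) U"
  using assms(2,3)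
proof (induction k arbitrary: f g)
  case 0
  then show ?case by (auto intro: continuous_on_add)
next
  case (Suc k)
  show ?case
    by (rule Ck_on_Suc_has_derivativeI[OF assms(1) has_derivative_add])
      (auto intro: Ck_on_SucD[OF Suc.prems(1)] Ck_on_SucD[OF Suc.prems(2)] Suc.IH)
qed

lemma Ck_on_mult:
  fixes f g :: "'a::euclidean_space \<Rightarrow> real"
  assumes "open U" "Ck_on k f U" "Ck_on k g U"
  shows "Ck_on k (\<lambda>x. f x * g x) U"
  using assms(2,3)
proof (induction k arbitrary: f g)
  case 0
  then show ?case by (auto intro: continuous_on_mult)
next
  case (Suc k)
  show ?case
    by (rule Ck_on_Suc_has_derivativeI[OF assms(1) has_derivative_mult])
      (auto intro!: Ck_on_add assms(1) Suc.IH
        intro: Ck_on_SucD[OF Suc.prems(1)] Ck_on_SucD[OF Suc.prems(2)] Suc.prems Ck_on_Suc_imp)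
qed

text \<open>
  The derivative of \<open>1/f\<close> is a product of \<open>f'\<close> with two copies of \<open>1/f\<close> itself, so
  the induction on \<open>k\<close> closes up.
\<close>
lemma Ck_on_inverse:
  fixes f :: "'a::euclidean_space \<Rightarrow> real"
  assumes "open U" "Ck_on k f U" "\<And>x. x \<in> U \<Longrightarrow> f x \<noteq> 0"
  shows "Ck_on k (\<lambda>x. inverse (f x)) U"
  using assms(2)
proof (induction k)
  case 0
  then show ?case using assms(3) by (auto intro: continuous_on_inverse)
next
  case (Suc k)
  have IH: "Ck_on k (\<lambda>x. inverse (f x)) U"
    by (rule Suc.IH[OF Ck_on_Suc_imp[OF Suc.prems]])
  have "Ck_on k (\<lambda>x. (- 1) * (inverse (f x) * frechet_derivative f (at x) v * inverse (f x))) U" for v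
    by (intro Ck_on_mult Ck_on_const IH Ck_on_SucD[OF Suc.prems] assms(1))
  then show ?case
    by (intro Ck_on_Suc_has_derivativeI[OF assms(1) Deriv.has_derivative_inverse])
      (auto intro: Ck_on_SucD[OF Suc.prems] simp: assms(3))
qed

lemma Ck_on_ln:
  fixes f :: "'a::euclidean_space \<Rightarrow> real"
  assumes "open U" "Ck_on k f U" "\<And>x. x \<in> U \<Longrightarrow> f x > 0"
  shows "Ck_on k (\<lambda>x. ln (f x)) U"
proof (cases k)
  case 0
  then show ?thesis
    using assms by (auto intro!: continuous_on_ln simp: less_le)
next
  case (Suc j)
  note f = assms(2)[unfolded Suc]
  have nz: "f x \<noteq> 0" if "x \<in> U" for x
    using assms(3)[OF that] by simp
  have "((\<lambda>x. ln (f x)) has_derivative (\<lambda>v. frechet_derivative f (at x) v * inverse (f x))) (at x)"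
    if "x \<in> U" for x
    using Ck_on_SucD(1)[OF f that] assms(3)[OF that]
    by (auto intro!: derivative_eq_intros simp: field_simps)
  then show ?thesis
    unfolding Suc
    by (rule Ck_on_Suc_has_derivativeI[OF assms(1)])
      (auto intro!: Ck_on_mult Ck_on_inverse nz assms(1) intro: Ck_on_SucD[OF f] Ck_on_Suc_imp[OF f])
qed

text \<open>
  Each of the two functions occurs in the derivative of the other, hence the joint induction.
\<close>
lemma Ck_on_sin_cos:
  fixes f :: "'a::euclidean_space \<Rightarrow> real"
  assumes "open U" "Ck_on k f U"
  shows "Ck_on k (\<lambda>x. sin (f x)) U" and "Ck_on k (\<lambda>x. cos (f x)) U"
proof -
  have "Ck_on k (\<lambda>x. sin (f x)) U \<and> Ck_on k (\<lambda>x. cos (f x)) U"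
    using assms(2)
  proof (induction k)
    case 0
    then show ?case by (auto intro: continuous_on_sin continuous_on_cos)
  next
    case (Suc k)
    have IH: "Ck_on k (\<lambda>x. sin (f x)) U" "Ck_on k (\<lambda>x. cos (f x)) U"
      using Suc.IH[OF Ck_on_Suc_imp[OF Suc.prems]] by auto
    have "Ck_on k (\<lambda>x. frechet_derivative f (at x) v * cos (f x)) U"
      "Ck_on k (\<lambda>x. frechet_derivative f (at x) v * ((- 1) * sin (f x))) U" for v
      by (intro Ck_on_mult Ck_on_const IH Ck_on_SucD[OF Suc.prems] assms(1))+
    then show ?case
      by (intro conjI; intro Ck_on_Suc_has_derivativeI[OF assms(1)])
        (auto intro!: derivative_eq_intros Ck_on_SucD[OF Suc.prems])
  qed
  then show "Ck_on k (\<lambda>x. sin (f x)) U" "Ck_on k (\<lambda>x. cos (f x)) U" by auto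
qed

section \<open>Surfaces of revolution\<close>

definition rotational_metric :: "(real \<Rightarrow> real) \<Rightarrow> real^2 \<Rightarrow> real^2^2" where
  "rotational_metric w x = vector [vector [1, 0], vector [0, w (x $ 1)]]"

lemma vector_2_eq_iff: "(v :: 'a::zero^2) = vector [a, b] \<longleftrightarrow> v $ 1 = a \<and> v $ 2 = b"
  by (auto simp: vec_eq_iff forall_2)

lemma has_derivative_vector_2:
  assumes "(a has_derivative a') (at x)" "(b has_derivative b') (at x)"
  shows "((\<lambda>x. vector [a x, b x] :: real^2) has_derivative (\<lambda>v. vector [a' v, b' v])) (at x)"
proof -
  have *: "(vector [c, d] :: real^2) = c *\<^sub>R axis 1 1 + d *\<^sub>R axis 2 1" for c d
    by (auto simp: vec_eq_iff forall_2 axis_def)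
  show ?thesis
    unfolding * by (auto intro!: derivative_eq_intros assms)
qed

lemma has_derivative_nth_real:
  "(a has_real_derivative a') (at (x $ i)) \<Longrightarrow>
    ((\<lambda>x. a (x $ i)) has_derivative (\<lambda>v. a' * v $ i)) (at (x :: real^'n))"
  using has_derivative_compose[of "\<lambda>x. x $ i" "\<lambda>v. v $ i" x UNIV a "(*) a'"]
  by (auto simp: has_field_derivative_def bounded_linear_vec_nth
      intro: bounded_linear_imp_has_derivative)

lemma matrix_inv_eqI:
  fixes A :: "'a::semiring_1^'n^'m"
  assumes "A ** B = mat 1" "B ** A = mat 1"
  shows "matrix_inv A = B"
proof -
  have "A ** matrix_inv A = mat 1 \<and> matrix_inv A ** A = mat 1"
    unfolding matrix_inv_def by (rule someI[where x = B]) (use assms in auto)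
  then show ?thesis
    by (metis assms(1) matrix_mul_assoc matrix_mul_lid matrix_mul_rid)
qed

lemma matrix_inv_rotational_metric:
  assumes "w (x $ 1) \<noteq> 0"
  shows "matrix_inv (rotational_metric w x) = vector [vector [1, 0], vector [0, 1 / w (x $ 1)]]"
  by (rule matrix_inv_eqI; use assms in
      \<open>auto simp: rotational_metric_def vec_eq_iff forall_2 matrix_matrix_mult_def sum_2 mat_def\<close>)

lemma metric_trace_rotational_metric:
  assumes "w (x $ 1) \<noteq> 0"
  shows "metric_trace (rotational_metric w) x B =
    B (\<lambda>_. axis 1 1) (\<lambda>_. axis 1 1) + (1 / w (x $ 1)) *\<^sub>R B (\<lambda>_. axis 2 1) (\<lambda>_. axis 2 1)"
  unfolding metric_trace_def matrix_inv_rotational_metric[of w, OF assms] by (simp add: sum_2)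

text \<open>
  The only Christoffel symbols that do not vanish are \<open>\<Gamma>\<^sup>1\<^sub>2\<^sub>2 = -w'/2\<close> and
  \<open>\<Gamma>\<^sup>2\<^sub>1\<^sub>2 = \<Gamma>\<^sup>2\<^sub>2\<^sub>1 = w'/(2w)\<close>, since the metric depends on the first coordinate
  alone.
\<close>
lemma christoffel_form_rotational_metric:
  assumes "(w has_real_derivative w') (at (x $ 1))" "w (x $ 1) \<noteq> 0"
  shows "christoffel_form (rotational_metric w) x u v =
    vector [- w' / 2 * u $ 2 * v $ 2, w' / (2 * w (x $ 1)) * (u $ 1 * v $ 2 + u $ 2 * v $ 1)]"
proof -
  have c: "partial_deriv i (\<lambda>y. c) x = 0" for i and c :: real
    by (simp add: partial_deriv_def)
  have w: "partial_deriv i (\<lambda>y. w (y $ 1)) x = w' * axis i 1 $ 1" for i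
    unfolding partial_deriv_def
    using frechet_derivative_at[OF has_derivative_nth_real[OF assms(1)]] by metis
  have entries: "rotational_metric w y $ 1 $ 1 = 1" "rotational_metric w y $ 1 $ 2 = 0"
    "rotational_metric w y $ 2 $ 1 = 0" "rotational_metric w y $ 2 $ 2 = w (y $ 1)" for y
    by (auto simp: rotational_metric_def)
  show ?thesis
    unfolding vector_2_eq_iff christoffel_form_def christoffel_def
      matrix_inv_rotational_metric[of w, OF assms(2)]
    using assms(2) by (auto simp: sum_2 entries c w axis_def field_simps)
qed

lemma cov_deriv_const_rotational_metric:
  assumes "(w has_real_derivative w') (at (x $ 1))" "w (x $ 1) \<noteq> 0"
  shows "cov_deriv (rotational_metric w) (\<lambda>_. u) (\<lambda>_. v) x =
    vector [- w' / 2 * u $ 2 * v $ 2, w' / (2 * w (x $ 1)) * (u $ 1 * v $ 2 + u $ 2 * v $ 1)]"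
  unfolding cov_deriv_def christoffel_form_rotational_metric[of w, OF assms] by simp

lemma open_vec_nth_vimage: "open I \<Longrightarrow> open {x :: real^'n. x $ i \<in> I}"
  using open_vimage[of I "\<lambda>x. x $ i"] by (simp add: vimage_def continuous_on_component)

text \<open>
  On a surface the curvature tensor is determined by one function; here \<open>\<kappa>/h\<close> is the Gaussian
  curvature. The constant-component extensions commute, so the bracket term vanishes and only
  the iterated covariant derivatives have to be computed.
\<close>
lemma curvature_rotational_metric:
  assumes "open J" "y $ 1 \<in> J"
    and h: "\<And>s. s \<in> J \<Longrightarrow> (h has_real_derivative h' s) (at s)"
    and h': "\<And>s. s \<in> J \<Longrightarrow> (h' has_real_derivative h'' s) (at s)"
    and nz: "\<And>s. s \<in> J \<Longrightarrow> h s \<noteq> 0"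
  defines "\<kappa> \<equiv> (h' (y $ 1))\<^sup>2 / (4 * h (y $ 1)) - h'' (y $ 1) / 2"
  shows "curvature (rotational_metric h) y u v z =
    (u $ 2 * v $ 1 - u $ 1 * v $ 2) *\<^sub>R vector [- \<kappa> * z $ 2, \<kappa> / h (y $ 1) * z $ 1]"
proof -
  let ?g = "rotational_metric h" and ?s = "y $ 1"
  note in_J = h[OF assms(2)] h'[OF assms(2)] nz[OF assms(2)]
  have cov: "cov_deriv ?g (\<lambda>_. a) (cov_deriv ?g (\<lambda>_. b) (\<lambda>_. c)) y =
    vector [- h'' ?s / 2 * b $ 2 * c $ 2 * a $ 1,
      (h'' ?s / (2 * h ?s) - (h' ?s)\<^sup>2 / (2 * (h ?s)\<^sup>2)) * (b $ 1 * c $ 2 + b $ 2 * c $ 1) * a $ 1] +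
    christoffel_form ?g y a (vector [- h' ?s / 2 * b $ 2 * c $ 2,
      h' ?s / (2 * h ?s) * (b $ 1 * c $ 2 + b $ 2 * c $ 1)])" for a b c
  proof -
    have "frechet_derivative (cov_deriv ?g (\<lambda>_. b) (\<lambda>_. c)) (at y) =
      (\<lambda>a. vector [- h'' ?s / 2 * b $ 2 * c $ 2 * a $ 1,
        (h'' ?s / (2 * h ?s) - (h' ?s)\<^sup>2 / (2 * (h ?s)\<^sup>2)) * (b $ 1 * c $ 2 + b $ 2 * c $ 1) * a $ 1])"
    proof (rule frechet_derivative_eqI[OF has_derivative_vector_2 open_vec_nth_vimage[OF assms(1)]])
      show "cov_deriv ?g (\<lambda>_. b) (\<lambda>_. c) x = vector [- h' (x $ 1) / 2 * b $ 2 * c $ 2,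
          h' (x $ 1) / (2 * h (x $ 1)) * (b $ 1 * c $ 2 + b $ 2 * c $ 1)]"
        if "x \<in> {x. x $ 1 \<in> J}" for x
        using that by (intro cov_deriv_const_rotational_metric) (simp_all add: h nz)
    qed (use assms(2) in_J in \<open>auto intro!: has_derivative_nth_real derivative_eq_intros
          simp: nz field_simps power2_eq_square\<close>)
    then show ?thesis
      unfolding cov_deriv_def[of ?g "\<lambda>_. a"]
      by (simp add: cov_deriv_const_rotational_metric[of h, OF in_J(1,3)])
  qed
  have bracket: "cov_deriv ?g (lie_bracket (\<lambda>_. u) (\<lambda>_. v)) (\<lambda>_. z) y = 0"
    unfolding cov_deriv_def lie_bracket_def
      christoffel_form_rotational_metric[of h, OF in_J(1,3)]
    by (auto simp: vec_eq_iff forall_2)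
  show ?thesis
    unfolding curvature_def curvature_field_def cov bracket
      christoffel_form_rotational_metric[of h, OF in_J(1,3)]
    by (simp add: vec_eq_iff forall_2 \<kappa>_def power2_eq_square algebra_simps
        add_divide_distrib diff_divide_distrib)
qed

section \<open>Rotationally symmetric maps\<close>

text \<open>
  The derivatives of \<open>w\<close>, \<open>h\<close> and \<open>F\<close> are parameters rather than applications of \<open>deriv\<close>, so that
  the formulas for the tension fields come out in closed form when the locale is interpreted.
\<close>
locale rotational_map =
  fixes I J :: "real set"
    and w w' h h' h'' F F' F'' :: "real \<Rightarrow> real"
  assumes open_I: "open I" and open_J: "open J"
    and F_in: "r \<in> I \<Longrightarrow> F r \<in> J"
    and w_deriv: "r \<in> I \<Longrightarrow> (w has_real_derivative w' r) (at r)"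
    and w_nz: "r \<in> I \<Longrightarrow> w r \<noteq> 0"
    and h_deriv: "s \<in> J \<Longrightarrow> (h has_real_derivative h' s) (at s)"
    and h'_deriv: "s \<in> J \<Longrightarrow> (h' has_real_derivative h'' s) (at s)"
    and h_nz: "s \<in> J \<Longrightarrow> h s \<noteq> 0"
    and F_deriv: "r \<in> I \<Longrightarrow> (F has_real_derivative F' r) (at r)"
    and F'_deriv: "r \<in> I \<Longrightarrow> (F' has_real_derivative F'' r) (at r)"
begin

abbreviation "U \<equiv> {x :: real^2. x $ 1 \<in> I}"

abbreviation \<phi> :: "real^2 \<Rightarrow> real^2" where "\<phi> x \<equiv> vector [F (x $ 1), x $ 2]"

lemma push_forward_eq:
  assumes "x \<in> U"
  shows "push_forward \<phi> X x = vector [F' (x $ 1) * X x $ 1, X x $ 2]"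
proof -
  have "(\<phi> has_derivative (\<lambda>v. vector [F' (x $ 1) * v $ 1, v $ 2])) (at x)"
    using assms
    by (intro has_derivative_vector_2 has_derivative_nth_real F_deriv)
      (auto intro: bounded_linear_imp_has_derivative bounded_linear_vec_nth)
  from frechet_derivative_at[OF this] show ?thesis
    unfolding push_forward_def by (auto dest: fun_cong[where x = "X x"])
qed

text \<open>
  Every section that occurs in the tension and bitension fields depends on \<open>r\<close> alone, since
  rotations act by isometries that commute with the map. The pull-back connection is needed
  only on such sections.
\<close>
lemma pullback_deriv_eq:
  assumes "x \<in> U" "\<And>y. y \<in> U \<Longrightarrow> V y = vector [a (y $ 1), b (y $ 1)]"
    and "(a has_real_derivative a') (at (x $ 1))" "(b has_real_derivative b') (at (x $ 1))"
  shows "pullback_deriv (rotational_metric h) \<phi> X V x =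
    vector [a' * X x $ 1 - h' (F (x $ 1)) / 2 * X x $ 2 * b (x $ 1),
      b' * X x $ 1 + h' (F (x $ 1)) / (2 * h (F (x $ 1))) *
        (F' (x $ 1) * X x $ 1 * b (x $ 1) + X x $ 2 * a (x $ 1))]"
proof -
  have "frechet_derivative V (at x) = (\<lambda>v. vector [a' * v $ 1, b' * v $ 1])"
    by (rule frechet_derivative_eqI[OF has_derivative_vector_2[OF
            has_derivative_nth_real[OF assms(3)] has_derivative_nth_real[OF assms(4)]]
          open_vec_nth_vimage[OF open_I] assms(1,2)])
  moreover have "christoffel_form (rotational_metric h) (\<phi> x) u v =
      vector [- h' (F (x $ 1)) / 2 * u $ 2 * v $ 2,
        h' (F (x $ 1)) / (2 * h (F (x $ 1))) * (u $ 1 * v $ 2 + u $ 2 * v $ 1)]" for u v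
    using christoffel_form_rotational_metric[of h "h' (F (x $ 1))" "\<phi> x"] assms(1)
    by (auto intro!: h_deriv F_in simp: h_nz F_in)
  ultimately show ?thesis
    unfolding pullback_deriv_def push_forward_eq[OF assms(1)] assms(2)[OF assms(1)]
    by (auto simp: vec_eq_iff forall_2)
qed

text \<open>
  The summand with \<open>w'\<close> comes from \<open>\<nabla>\<^sub>\<theta> \<partial>\<^sub>\<theta> = -(w'/2) \<partial>\<^sub>r\<close> on the domain, the one with \<open>h'\<close>
  from the same formula on the target. The angular component vanishes because each of its
  terms pairs a radial with an angular component of one and the same frame vector.
\<close>
lemma tension_field_eq:
  assumes "x \<in> U"
  defines "r \<equiv> x $ 1"
  shows "tension_field (rotational_metric w) (rotational_metric h) \<phi> x =
    vector [F'' r + w' r * F' r / (2 * w r) - h' (F r) / (2 * w r), 0]"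
proof -
  have r: "r \<in> I" using assms by auto
  have *: "second_fundamental_form (rotational_metric w) (rotational_metric h) \<phi> (\<lambda>_. u) (\<lambda>_. u) x =
    vector [F'' r * u $ 1 * u $ 1 - h' (F r) / 2 * u $ 2 * u $ 2 + F' r * (w' r / 2 * u $ 2 * u $ 2),
      h' (F r) / (2 * h (F r)) * (F' r * u $ 1 * u $ 2 + u $ 2 * (F' r * u $ 1))
        - w' r / (2 * w r) * (u $ 1 * u $ 2 + u $ 2 * u $ 1)]" for u
  proof -
    have "pullback_deriv (rotational_metric h) \<phi> (\<lambda>_. u) (push_forward \<phi> (\<lambda>_. u)) x =
      vector [F'' r * u $ 1 * u $ 1 - h' (F r) / 2 * u $ 2 * u $ 2,
        0 * u $ 1 + h' (F r) / (2 * h (F r)) * (F' r * u $ 1 * u $ 2 + u $ 2 * (F' r * u $ 1))]"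
      unfolding r_def
    proof (rule pullback_deriv_eq[OF assms(1), where a = "\<lambda>s. F' s * u $ 1" and b = "\<lambda>_. u $ 2"])
      show "((\<lambda>s. F' s * u $ 1) has_real_derivative F'' (x $ 1) * u $ 1) (at (x $ 1))"
        using F'_deriv[OF r] unfolding r_def by (rule DERIV_cmult_right)
    qed (simp_all add: push_forward_eq)
    then show ?thesis
      unfolding second_fundamental_form_def push_forward_eq[OF assms(1)]
        cov_deriv_const_rotational_metric[of w, OF w_deriv[OF r, unfolded r_def] w_nz[OF r, unfolded r_def]]
      by (simp add: vec_eq_iff forall_2 r_def)
  qed
  show ?thesis
    unfolding tension_field_def metric_trace_rotational_metric[of w, OF w_nz[OF r, unfolded r_def]] *
    using w_nz[OF r] by (simp add: vec_eq_iff forall_2 axis_def r_def diff_divide_distrib add_divide_distrib)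
qed

text \<open>
  Since \<open>\<nabla>\<^sub>\<theta> (T \<partial>\<^sub>\<rho>) = T h'/(2h) \<partial>\<^sub>\<phi>\<close>, a second differentiation along the circle gives
  \<open>-T (h')\<^sup>2/(4h) \<partial>\<^sub>\<rho>\<close>. The curvature term is \<open>R(\<partial>\<^sub>\<phi>, T \<partial>\<^sub>\<rho>) \<partial>\<^sub>\<phi> = T (h''/2 - (h')\<^sup>2/(4h)) \<partial>\<^sub>\<rho>\<close>,
  and in the difference only \<open>h''\<close> is left. The function \<open>T\<close> is fixed separately from its
  formula, so that a simplified expression and its derivatives can be supplied.
\<close>
lemma bitension_field_eq:
  fixes T T' T'' :: "real \<Rightarrow> real"
  assumes T: "\<And>r. r \<in> I \<Longrightarrow> T r = F'' r + w' r * F' r / (2 * w r) - h' (F r) / (2 * w r)"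
    and T_deriv: "\<And>r. r \<in> I \<Longrightarrow> (T has_real_derivative T' r) (at r)"
    and T'_deriv: "\<And>r. r \<in> I \<Longrightarrow> (T' has_real_derivative T'' r) (at r)"
    and "x \<in> U"
  defines "r \<equiv> x $ 1"
  shows "bitension_field (rotational_metric w) (rotational_metric h) \<phi> x =
    vector [T'' r + w' r * T' r / (2 * w r) - h'' (F r) * T r / (2 * w r), 0]"
proof -
  let ?\<tau> = "tension_field (rotational_metric w) (rotational_metric h) \<phi>"
  let ?D = "pullback_deriv (rotational_metric h) \<phi>"
  have r: "r \<in> I" using assms by auto
  have \<tau>: "?\<tau> y = vector [T (y $ 1), 0]" if "y \<in> U" for y
    using that T by (simp add: tension_field_eq)
  have D: "?D X ?\<tau> y = vector [T' (y $ 1) * X y $ 1,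
      h' (F (y $ 1)) / (2 * h (F (y $ 1))) * (X y $ 2 * T (y $ 1))]" if "y \<in> U" for X y
    using pullback_deriv_eq[OF that \<tau> T_deriv DERIV_const, of X] that by simp
  have DD1: "?D (\<lambda>_. axis 1 1) (?D (\<lambda>_. axis 1 1) ?\<tau>) x = vector [T'' r, 0]"
    using pullback_deriv_eq[OF assms(4), where a = T' and b = "\<lambda>_. 0"
        and V = "?D (\<lambda>_. axis 1 1) ?\<tau>" and X = "\<lambda>_. axis 1 1", OF _ T'_deriv DERIV_const] assms(4)
    by (auto simp: D axis_def r_def)
  have "h (F r) \<noteq> 0"
    using h_nz[OF F_in[OF r]] .
  then obtain b' where b_deriv: "((\<lambda>s. h' (F s) / (2 * h (F s)) * T s) has_real_derivative b') (at r)"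
    using DERIV_mult[OF DERIV_divide[OF DERIV_chain2[OF h'_deriv[OF F_in] F_deriv, OF r r]
          DERIV_cmult[OF DERIV_chain2[OF h_deriv[OF F_in] F_deriv, OF r r], of 2]] T_deriv[OF r]]
    by auto
  have DD2: "?D (\<lambda>_. axis 2 1) (?D (\<lambda>_. axis 2 1) ?\<tau>) x =
    vector [- (h' (F r))\<^sup>2 / (4 * h (F r)) * T r, 0]"
    using pullback_deriv_eq[OF assms(4), where a = "\<lambda>_. 0" and b = "\<lambda>s. h' (F s) / (2 * h (F s)) * T s"
        and V = "?D (\<lambda>_. axis 2 1) ?\<tau>" and X = "\<lambda>_. axis 2 1",
        OF _ DERIV_const b_deriv[unfolded r_def]] assms(4)
    by (auto simp: D axis_def r_def vec_eq_iff forall_2 power2_eq_square)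
  have curv: "curvature (rotational_metric h) (\<phi> x) u v z =
    (u $ 2 * v $ 1 - u $ 1 * v $ 2) *\<^sub>R
      vector [- ((h' (F r))\<^sup>2 / (4 * h (F r)) - h'' (F r) / 2) * z $ 2,
        ((h' (F r))\<^sup>2 / (4 * h (F r)) - h'' (F r) / 2) / h (F r) * z $ 1]" for u v z
    using curvature_rotational_metric[of J "\<phi> x" h h' h'', OF open_J _ h_deriv h'_deriv h_nz] r
    by (simp add: F_in r_def)
  show ?thesis
    unfolding bitension_field_def Let_def
      metric_trace_rotational_metric[of w, OF w_nz[OF r, unfolded r_def]]
      DD1 DD2 curv D[OF assms(4)] push_forward_eq[OF assms(4)] \<tau>[OF assms(4)]
      cov_deriv_const_rotational_metric[of w, OF w_deriv[OF r, unfolded r_def] w_nz[OF r, unfolded r_def]]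
    by (simp add: vec_eq_iff forall_2 axis_def r_def power2_eq_square algebra_simps
        add_divide_distrib diff_divide_distrib)
qed

end

section \<open>The map of the sphere\<close>

lemma smooth_on_vector_2:
  assumes "open U" "\<And>k. Ck_on k a U" "\<And>k. Ck_on k b U"
  shows "smooth_on (\<lambda>x. vector [a x, b x] :: real^2) U"
proof -
  have *: "(vector [c, d] :: real^2) = c *\<^sub>R axis 1 1 + d *\<^sub>R axis 2 1" for c d
    by (auto simp: vec_eq_iff forall_2 axis_def)
  show ?thesis
    unfolding smooth_on_def *
    by (intro allI Ck_on_add Ck_on_bounded_linear[of "\<lambda>c. c *\<^sub>R _"] bounded_linear_scaleR_left assms)
qed

text \<open>
  Splitting off the one entry that varies reduces smoothness of the matrix to that of \<open>w\<close>.
\<close>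
lemma riemannian_metric_on_rotational_metric:
  assumes "open U" "\<And>k. Ck_on k (\<lambda>x. w (x $ 1)) U" "\<And>x. x \<in> U \<Longrightarrow> w (x $ 1) > 0"
  shows "riemannian_metric_on U (rotational_metric w)"
proof -
  have *: "rotational_metric w x = vector [vector [1, 0], 0] + w (x $ 1) *\<^sub>R vector [0, axis 2 1]" for x
    by (auto simp: rotational_metric_def vec_eq_iff forall_2 axis_def)
  have "smooth_on (rotational_metric w) U"
    unfolding smooth_on_def *
    by (intro allI Ck_on_add Ck_on_const Ck_on_bounded_linear[of "\<lambda>c. c *\<^sub>R _"]
        bounded_linear_scaleR_left assms)
  moreover have "v \<bullet> (rotational_metric w x *v v) > 0" if "x \<in> U" "v \<noteq> 0" for x v
  proof -
    have "v \<bullet> (rotational_metric w x *v v) = (v $ 1)\<^sup>2 + w (x $ 1) * (v $ 2)\<^sup>2"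
      by (simp add: inner_vec_def sum_2 matrix_vector_mult_def rotational_metric_def power2_eq_square)
    moreover have "v $ 1 \<noteq> 0 \<or> v $ 2 \<noteq> 0"
      using that(2) by (auto simp: vec_eq_iff forall_2)
    ultimately show ?thesis
      using assms(3)[OF that(1)]
      by (auto intro: add_pos_nonneg add_nonneg_pos)
  qed
  ultimately show ?thesis
    unfolding riemannian_metric_on_def
    by (auto simp: assms(1) rotational_metric_def vec_eq_iff forall_2 transpose_def)
qed

lemma Ck_on_nth: "open U \<Longrightarrow> Ck_on k (\<lambda>x :: real^'n. x $ i) U"
  by (rule Ck_on_bounded_linear[OF bounded_linear_vec_nth _ Ck_on_ident])

definition profile :: "real \<Rightarrow> real" where
  "profile r = 1/4 * (ln (tan (r / 2)))\<^sup>2 - ln (sin r) + 1"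

lemma DERIV_ln_tan_half:
  assumes "0 < r" "r < pi"
  shows "((\<lambda>r. ln (tan (r / 2))) has_real_derivative 1 / sin r) (at r)"
proof -
  have pos: "sin (r / 2) > 0" "cos (r / 2) > 0"
    using assms by (auto intro: sin_gt_zero cos_gt_zero)
  have "((\<lambda>r. ln (tan (r / 2))) has_real_derivative
      1 / tan (r / 2) * (inverse ((cos (r / 2))\<^sup>2) * (1 / 2))) (at r)"
    using pos by (intro DERIV_chain2[OF DERIV_ln_divide] DERIV_chain2[OF DERIV_tan] DERIV_cdivide DERIV_ident)
      (auto simp: tan_def)
  moreover have "1 / tan (r / 2) * (inverse ((cos (r / 2))\<^sup>2) * (1 / 2)) = 1 / sin r"
    using pos sin_double[of "r / 2"] by (simp add: tan_def field_simps power2_eq_square)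
  ultimately show ?thesis by simp
qed

text \<open>
  The profile takes values in the target because both \<open>L\<^sup>2/4\<close> and \<open>-ln sin r\<close> are nonnegative.
\<close>
interpretation sphere: rotational_map "{0<..<pi}" "{-1<..}"
  "\<lambda>r. (sin r)\<^sup>2" "\<lambda>r. 2 * sin r * cos r"
  "\<lambda>s. s + 1" "\<lambda>_. 1" "\<lambda>_. 0"
  profile "\<lambda>r. ln (tan (r / 2)) / (2 * sin r) - cos r / sin r"
  "\<lambda>r. 3 / (2 * (sin r)\<^sup>2) - ln (tan (r / 2)) * cos r / (2 * (sin r)\<^sup>2)"
proof
  fix r :: real assume r: "r \<in> {0<..<pi}"
  then have s: "sin r > 0" by (auto intro: sin_gt_zero)
  have "ln (sin r) \<le> 0" using s by simp
  then show "profile r \<in> {-1<..}"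
    using zero_le_power2[of "ln (tan (r / 2))"] unfolding profile_def greaterThan_iff by linarith
  have dL: "((\<lambda>r. ln (tan (r / 2))) has_real_derivative 1 / sin r) (at r)"
    using r DERIV_ln_tan_half by auto
  show "(profile has_real_derivative ln (tan (r / 2)) / (2 * sin r) - cos r / sin r) (at r)"
    unfolding profile_def[abs_def]
    by (rule derivative_eq_intros dL refl | use s in \<open>simp add: field_simps\<close>)+
  have "(1 / sin r * (2 * sin r) - ln (tan (r / 2)) * (2 * cos r)) / (2 * sin r * (2 * sin r))
      - (- sin r * sin r - cos r * cos r) / (sin r * sin r)
    = 3 / (2 * (sin r)\<^sup>2) - ln (tan (r / 2)) * cos r / (2 * (sin r)\<^sup>2)"
  proof -
    have *: "- sin r * sin r - cos r * cos r = - 1"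
      using sin_cos_squared_add3[of r] by linarith
    show ?thesis
      unfolding *
      using s by (simp add: field_simps power2_eq_square)
  qed
  then show "((\<lambda>r. ln (tan (r / 2)) / (2 * sin r) - cos r / sin r) has_real_derivative
      3 / (2 * (sin r)\<^sup>2) - ln (tan (r / 2)) * cos r / (2 * (sin r)\<^sup>2)) (at r)"
    using DERIV_diff[OF DERIV_divide[OF dL DERIV_cmult[OF DERIV_sin, of 2]]
        DERIV_divide[OF DERIV_cos DERIV_sin]] s
    by simp
qed (auto intro!: derivative_eq_intros dest: sin_gt_zero)

text \<open>
  The function \<open>T\<close> of the map is identically 1. The terms with \<open>ln (tan (r / 2))\<close> cancel, and
  \<open>(3 - 2 cos\<^sup>2 r - 1)/(2 sin\<^sup>2 r)\<close> is left.
\<close>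
lemma profile_tension:
  assumes "r \<in> {0<..<pi}"
  shows "3 / (2 * (sin r)\<^sup>2) - ln (tan (r / 2)) * cos r / (2 * (sin r)\<^sup>2)
    + 2 * sin r * cos r * (ln (tan (r / 2)) / (2 * sin r) - cos r / sin r) / (2 * (sin r)\<^sup>2)
    - 1 / (2 * (sin r)\<^sup>2) = 1" (is "?lhs = 1")
proof -
  have s: "sin r > 0" using assms by (auto intro: sin_gt_zero)
  then have "?lhs = (1 - (cos r)\<^sup>2) / (sin r)\<^sup>2"
    by (simp add: field_simps power2_eq_square)
  then show ?thesis
    using s by (simp add: sin_squared_eq[symmetric])
qed

lemma smooth_on_profile_map:
  "smooth_on (\<lambda>x :: real^2. vector [profile (x $ 1), x $ 2] :: real^2) {x. x $ 1 \<in> {0<..<pi}}"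
proof -
  let ?U = "{x :: real^2. x $ 1 \<in> {0<..<pi}}"
  have U: "open ?U" by (rule open_vec_nth_vimage) simp
  have pos: "sin (x $ 1) > 0" "sin (1/2 * x $ 1) > 0" "cos (1/2 * x $ 1) > 0" if "x \<in> ?U" for x
    using that by (auto intro: sin_gt_zero cos_gt_zero)
  have "Ck_on k (\<lambda>x :: real^2.
      1/4 * (ln (sin (1/2 * x $ 1) * inverse (cos (1/2 * x $ 1))) *
        ln (sin (1/2 * x $ 1) * inverse (cos (1/2 * x $ 1))))
      + (-1) * ln (sin (x $ 1)) + 1) ?U" for k
    using pos
    by (intro Ck_on_add Ck_on_mult Ck_on_ln Ck_on_inverse Ck_on_sin_cos Ck_on_const Ck_on_nth U)
      (force intro: mult_pos_pos)+
  \<comment> \<open>The products and inverses in place of squares, differences and quotients match the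
    closure rules.\<close>
  moreover have "profile r = 1/4 * (ln (sin (1/2 * r) * inverse (cos (1/2 * r))) *
        ln (sin (1/2 * r) * inverse (cos (1/2 * r)))) + (-1) * ln (sin r) + 1" for r
    by (simp add: profile_def tan_def power2_eq_square divide_inverse[symmetric])
  ultimately have "Ck_on k (\<lambda>x :: real^2. profile (x $ 1)) ?U" for k
    by simp
  then show ?thesis
    by (intro smooth_on_vector_2 U Ck_on_nth)
qed

theorem theorem4p4:
  shows "proper_biharmonic_map sphere_polar_domain sphere_polar_metric target_domain target_metric
    (\<lambda>x. vector [1/4 * (ln (tan (x $ 1 / 2)))\<^sup>2 - ln (sin (x $ 1)) + 1, x $ 2])"
proof -
  have U: "sphere_polar_domain = {x. x $ 1 \<in> {0<..<pi}}"
    by (auto simp: sphere_polar_domain_def)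
  have g: "sphere_polar_metric = rotational_metric (\<lambda>r. (sin r)\<^sup>2)"
    by (auto simp: sphere_polar_metric_def rotational_metric_def fun_eq_iff)
  have V: "target_domain = {y. y $ 1 \<in> {-1<..}}"
    by (auto simp: target_domain_def)
  have h: "target_metric = rotational_metric (\<lambda>s. s + 1)"
    by (auto simp: target_metric_def rotational_metric_def fun_eq_iff)
  have \<phi>: "(\<lambda>x. vector [1/4 * (ln (tan (x $ 1 / 2)))\<^sup>2 - ln (sin (x $ 1)) + 1, x $ 2]) = sphere.\<phi>"
    by (simp add: profile_def)
  have open_domains: "open sphere.U" "open {y :: real^2. y $ 1 \<in> {-1<..}}"
    by (rule open_vec_nth_vimage; simp)+
  have "riemannian_metric_on sphere.U (rotational_metric (\<lambda>r. (sin r)\<^sup>2))"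
  proof (rule riemannian_metric_on_rotational_metric[OF open_domains(1)])
    show "Ck_on k (\<lambda>x :: real^2. (sin (x $ 1))\<^sup>2) sphere.U" for k
      unfolding power2_eq_square
      by (intro Ck_on_mult Ck_on_sin_cos Ck_on_nth open_domains)
  qed (use sin_gt_zero in force)
  moreover have "riemannian_metric_on {y. y $ 1 \<in> {-1<..}} (rotational_metric (\<lambda>s. s + 1))"
    by (rule riemannian_metric_on_rotational_metric)
      (use open_domains in \<open>auto intro!: Ck_on_add Ck_on_nth Ck_on_const\<close>)
  ultimately have "smooth_riemannian_map sphere.U (rotational_metric (\<lambda>r. (sin r)\<^sup>2))
      {y. y $ 1 \<in> {-1<..}} (rotational_metric (\<lambda>s. s + 1)) sphere.\<phi>"
    unfolding smooth_riemannian_map_def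
    using sphere.F_in smooth_on_profile_map by fastforce
  moreover have "bitension_field (rotational_metric (\<lambda>r. (sin r)\<^sup>2)) (rotational_metric (\<lambda>s. s + 1))
      sphere.\<phi> x = 0" if "x \<in> sphere.U" for x
    using sphere.bitension_field_eq[of "\<lambda>_. 1" "\<lambda>_. 0" "\<lambda>_. 0", OF profile_tension[symmetric] _ _ that]
    by (auto simp: vec_eq_iff forall_2)
  moreover have "tension_field (rotational_metric (\<lambda>r. (sin r)\<^sup>2)) (rotational_metric (\<lambda>s. s + 1))
      sphere.\<phi> x \<noteq> 0" if "x \<in> sphere.U" for x
    using sphere.tension_field_eq[OF that] profile_tension[of "x $ 1"] that
    by (auto simp: vec_eq_iff forall_2)
  \<comment> \<open>A point of the domain, where harmonicity fails.\<close>
  moreover have "vector [1, 0] \<in> sphere.U"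
    using pi_gt3 by simp
  ultimately show ?thesis
    unfolding U g V h \<phi> proper_biharmonic_map_def biharmonic_map_def harmonic_map_def by blast
qed

end
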